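(* Let $(X,d)$ be a complete metric space, $(X,\delta)$ a semimetric space, and let $T\colon X\to X$ be an A.M.-G.M. contraction with respect to $\delta$, i.e. there exists $\alpha\in[0,1)$ such that $$\frac{d(Tx,Ty)+\delta(Tx,Ty)}{2}\le\alpha\,\big(d(x,y)\,\delta(x,y)\big)^{1/2}\quad\text{for all }x,y\in X.$$ If $\delta$ is $d$-regular, then $T$ is a Picard operator on $(X,d)$.
   Context: $X$ is a nonempty set. $(X,\delta)$ is a semimetric space if $\delta\colon X\times X\to[0,\infty)$ is a semimetric, i.e. $\delta(x,y)=0$ if and only if $x=y$, and $\delta(x,y)=\delta(y,x)$ for all $x,y\in X$ (no triangle inequality is required). The semimetric $\delta$ is $d$-regular if for every $x^*\in X$ and every sequence $(x_n)$ in $X$ with $d(x_n,x^* )\to0$ we have $d(x_n,x^* )\delta(x_n,x^* )\to0$. A self-mapping $T$ of a metric space $(X,d)$ is called a Picard operator if $T$ has a unique fixed point $u\in X$ and for every $x\in X$ the sequence of iterates $(T^n x)$ converges to $u$ in $(X,d)$. *)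

theory Defs
  imports "HOL-Analysis.Analysis"
begin

text \<open>
  As with the library locale \<^locale>\<open>Metric_space\<close>, spaces are given by an explicit carrier set.
  Nothing is required of the semimetric outside its carrier.
\<close>

locale Semimetric_space =
  fixes X :: "'a set" and \<delta> :: "'a \<Rightarrow> 'a \<Rightarrow> real"
  assumes nonneg: "\<And>x y. \<lbrakk>x \<in> X; y \<in> X\<rbrakk> \<Longrightarrow> 0 \<le> \<delta> x y"
    and zero: "\<And>x y. \<lbrakk>x \<in> X; y \<in> X\<rbrakk> \<Longrightarrow> \<delta> x y = 0 \<longleftrightarrow> x = y"
    and commute: "\<And>x y. \<lbrakk>x \<in> X; y \<in> X\<rbrakk> \<Longrightarrow> \<delta> x y = \<delta> y x"

definition regular_semimetric ::
    "'a set \<Rightarrow> ('a \<Rightarrow> 'a \<Rightarrow> real) \<Rightarrow> ('a \<Rightarrow> 'a \<Rightarrow> real) \<Rightarrow> bool"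
  where "regular_semimetric X d \<delta> \<longleftrightarrow>
    (\<forall>z\<in>X. \<forall>x::nat \<Rightarrow> 'a. (\<forall>n. x n \<in> X) \<longrightarrow> (\<lambda>n. d (x n) z) \<longlonglongrightarrow> 0 \<longrightarrow>
       (\<lambda>n. d (x n) z * \<delta> (x n) z) \<longlonglongrightarrow> 0)"

definition AMGM_contraction ::
    "'a set \<Rightarrow> ('a \<Rightarrow> 'a \<Rightarrow> real) \<Rightarrow> ('a \<Rightarrow> 'a \<Rightarrow> real) \<Rightarrow> ('a \<Rightarrow> 'a) \<Rightarrow> bool"
  where "AMGM_contraction X d \<delta> T \<longleftrightarrow>
    (\<exists>\<alpha>::real. 0 \<le> \<alpha> \<and> \<alpha> < 1 \<and>
       (\<forall>x\<in>X. \<forall>y\<in>X. (d (T x) (T y) + \<delta> (T x) (T y)) / 2 \<le> \<alpha> * sqrt (d x y * \<delta> x y)))"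

definition Picard_operator ::
    "'a set \<Rightarrow> ('a \<Rightarrow> 'a \<Rightarrow> real) \<Rightarrow> ('a \<Rightarrow> 'a) \<Rightarrow> bool"
  where "Picard_operator X d T \<longleftrightarrow>
    (\<exists>u\<in>X. T u = u \<and> (\<forall>v\<in>X. T v = v \<longrightarrow> v = u) \<and>
       (\<forall>x\<in>X. limitin (Metric_space.mtopology X d) (\<lambda>n. (T ^^ n) x) u sequentially))"

end

theory Submission
  imports Defs
begin

text \<open>
  Write \<open>g x y = sqrt (d x y * \<delta> x y)\<close>. By the AM-GM inequality the hypothesis gives
  \<open>g (T x) (T y) \<le> \<alpha> * g x y\<close>, and since \<open>\<delta> \<ge> 0\<close> it also gives \<open>d (T x) (T y) \<le> 2 * \<alpha> * g x y\<close>.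
  Hence the \<open>d\<close>-distance of the \<open>n\<close>-th iterates of two points decays like \<open>\<alpha> ^ n\<close>, so orbits are
  Cauchy and all have the same limit. Regularity says that \<open>g (x n) u \<longlonglongrightarrow> 0\<close> as soon as
  \<open>d (x n) u \<longlonglongrightarrow> 0\<close>, so \<open>T (x n) \<longlonglongrightarrow> T u\<close>, and the limit of an orbit is a fixed point.
\<close>

text \<open>By the triangle inequality, the distance between two terms is at most a tail of a
  convergent geometric series. This is applied below to an orbit of \<open>T\<close>.\<close>

lemma (in Metric_space) MCauchy_geometric:
  assumes "range \<sigma> \<subseteq> M" "0 \<le> r" "r < 1"
    and step: "\<And>n. d (\<sigma> n) (\<sigma> (Suc n)) \<le> C * r ^ n"
  shows "MCauchy \<sigma>"
  unfolding MCauchy_def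
proof (intro conjI allI impI)
  fix \<epsilon> :: real assume "\<epsilon> > 0"
  have \<sigma>: "\<sigma> n \<in> M" for n using assms(1) by blast
  have "0 \<le> C" using order_trans[OF nonneg step[of 0]] by simp
  have bound: "d (\<sigma> n) (\<sigma> (n + k)) \<le> C * r ^ n / (1 - r)" for n k
  proof -
    \<comment> \<open>The exact partial sum of the series makes the induction on \<open>k\<close>
      close; dropping the factor \<open>1 - r ^ k\<close> afterwards makes the bound uniform in
      \<open>k\<close>.\<close>
    have "d (\<sigma> n) (\<sigma> (n + k)) \<le> C * r ^ n * (1 - r ^ k) / (1 - r)"
    proof (induction k)
      case 0
      then show ?case using \<sigma> by simp
    next
      case (Suc k)
      have "d (\<sigma> n) (\<sigma> (n + Suc k)) \<le> d (\<sigma> n) (\<sigma> (n + k)) + d (\<sigma> (n + k)) (\<sigma> (Suc (n + k)))"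
        using triangle \<sigma> by simp
      also have "\<dots> \<le> C * r ^ n * (1 - r ^ k) / (1 - r) + C * r ^ (n + k)"
        using Suc step by (intro add_mono)
      also have "\<dots> = C * r ^ n * (1 - r ^ Suc k) / (1 - r)"
        using \<open>r < 1\<close> by (simp add: field_simps power_add)
      finally show ?case .
    qed
    also have "\<dots> \<le> C * r ^ n / (1 - r)"
      using \<open>0 \<le> C\<close> \<open>0 \<le> r\<close> \<open>r < 1\<close>
      by (intro divide_right_mono mult_left_le) (auto simp: power_le_one)
    finally show ?thesis .
  qed
  have "(\<lambda>n. C * r ^ n / (1 - r)) \<longlonglongrightarrow> C * 0 / (1 - r)"
    using \<open>0 \<le> r\<close> \<open>r < 1\<close> by (intro tendsto_intros LIMSEQ_realpow_zero) auto
  then have "eventually (\<lambda>n. C * r ^ n / (1 - r) < \<epsilon>) sequentially"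
    using \<open>\<epsilon> > 0\<close> by (intro order_tendstoD(2)) auto
  then obtain N where N: "\<And>n. N \<le> n \<Longrightarrow> C * r ^ n / (1 - r) < \<epsilon>"
    by (auto simp: eventually_sequentially)
  have "d (\<sigma> n) (\<sigma> n') < \<epsilon>" if "N \<le> n" "n \<le> n'" for n n'
    using bound[of n "n' - n"] N[OF that(1)] that(2) by simp
  then show "\<exists>N. \<forall>n n'. N \<le> n \<longrightarrow> N \<le> n' \<longrightarrow> d (\<sigma> n) (\<sigma> n') < \<epsilon>"
    by (metis commute nat_le_linear)
qed (use assms(1) in blast)

theorem corollary2p10:
  fixes X :: "'a set" and d \<delta> :: "'a \<Rightarrow> 'a \<Rightarrow> real" and T :: "'a \<Rightarrow> 'a"
  assumes "X \<noteq> {}"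
    and "Metric_space X d"
    and "Metric_space.mcomplete X d"
    and "Semimetric_space X \<delta>"
    and "T \<in> X \<rightarrow> X"
    and "AMGM_contraction X d \<delta> T"
    and "regular_semimetric X d \<delta>"
  shows "Picard_operator X d T"
proof -
  interpret Metric_space X d by fact
  interpret \<delta>: Semimetric_space X \<delta> by fact
  define g where "g x y = sqrt (d x y * \<delta> x y)" for x y
  obtain \<alpha> where \<alpha>: "0 \<le> \<alpha>" "\<alpha> < 1"
    and contr: "\<And>x y. x \<in> X \<Longrightarrow> y \<in> X \<Longrightarrow> (d (T x) (T y) + \<delta> (T x) (T y)) / 2 \<le> \<alpha> * g x y"
    using assms(6) unfolding AMGM_contraction_def g_def by blast
  have T: "T x \<in> X" if "x \<in> X" for x using assms(5) that by blast
  have iter: "(T ^^ n) x \<in> X" if "x \<in> X" for n x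
    using that T by (induction n) auto
  have d_le: "d (T x) (T y) \<le> 2 * \<alpha> * g x y" if "x \<in> X" "y \<in> X" for x y
    using contr[OF that] \<delta>.nonneg[OF T T, OF that] by simp
  have g_le: "g (T x) (T y) \<le> \<alpha> * g x y" if "x \<in> X" "y \<in> X" for x y
    using contr[OF that] arith_geo_mean_sqrt[OF nonneg \<delta>.nonneg[OF T T, OF that], of "T x" "T y"]
    by (simp add: g_def)
  have g_iter: "g ((T ^^ n) x) ((T ^^ n) y) \<le> \<alpha> ^ n * g x y" if "x \<in> X" "y \<in> X" for n x y
  proof (induction n)
    case (Suc n)
    have "g ((T ^^ Suc n) x) ((T ^^ Suc n) y) \<le> \<alpha> * g ((T ^^ n) x) ((T ^^ n) y)"
      using g_le iter that by simp
    also have "\<dots> \<le> \<alpha> * (\<alpha> ^ n * g x y)"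
      using Suc \<alpha>(1) by (rule mult_left_mono)
    finally show ?case by (simp add: mult.assoc)
  qed simp
  \<comment> \<open>One application of \<open>T\<close> is spent on passing from \<open>g\<close> to
    \<open>d\<close>, so the exponent of \<alpha> is one less than the number of iterations.\<close>
  have d_iter: "d ((T ^^ Suc n) x) ((T ^^ Suc n) y) \<le> 2 * \<alpha> * g x y * \<alpha> ^ n"
    if "x \<in> X" "y \<in> X" for n x y
  proof -
    have "d ((T ^^ Suc n) x) ((T ^^ Suc n) y) \<le> 2 * \<alpha> * g ((T ^^ n) x) ((T ^^ n) y)"
      using d_le iter that by simp
    also have "\<dots> \<le> 2 * \<alpha> * (\<alpha> ^ n * g x y)"
      using g_iter[OF that] \<alpha>(1) by (intro mult_left_mono) auto
    finally show ?thesis by (simp add: mult_ac)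
  qed
  have to_fixed: "limitin mtopology (\<lambda>n. (T ^^ n) x) u sequentially"
    if "x \<in> X" "u \<in> X" "T u = u" for x u
  proof -
    have fix_iter: "(T ^^ n) u = u" for n using \<open>T u = u\<close> by (induction n) auto
    have "(\<lambda>n. 2 * \<alpha> * g x u * \<alpha> ^ n) \<longlonglongrightarrow> 2 * \<alpha> * g x u * 0"
      using \<alpha> by (intro tendsto_intros LIMSEQ_realpow_zero) auto
    then have null: "(\<lambda>n. 2 * \<alpha> * g x u * \<alpha> ^ n) \<longlonglongrightarrow> 0"
      by simp
    have "norm (d ((T ^^ Suc n) x) u) \<le> 2 * \<alpha> * g x u * \<alpha> ^ n" for n
      using d_iter[OF that(1,2), of n] unfolding fix_iter by simp
    then have "(\<lambda>n. d ((T ^^ Suc n) x) u) \<longlonglongrightarrow> 0"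
      by (intro Lim_null_comparison[OF always_eventually null] allI)
    then have "(\<lambda>n. d ((T ^^ n) x) u) \<longlonglongrightarrow> 0"
      by (rule LIMSEQ_imp_Suc)
    then show ?thesis using that iter by (simp add: limitin_metric_dist_null)
  qed
  obtain x where x: "x \<in> X" using \<open>X \<noteq> {}\<close> by blast
  \<comment> \<open>The orbit starts at \<open>T x\<close>, since \<open>d_iter\<close> bounds
    distances only from the first iterate on.\<close>
  define \<sigma> where "\<sigma> n = (T ^^ Suc n) x" for n
  have \<sigma>: "\<sigma> n \<in> X" for n unfolding \<sigma>_def using iter x by blast
  have "MCauchy \<sigma>"
  proof (rule MCauchy_geometric)
    \<comment> \<open>Consecutive orbit terms are equal iterates of the two points \<open>x\<close>
      and \<open>T x\<close>.\<close>
    show "d (\<sigma> n) (\<sigma> (Suc n)) \<le> 2 * \<alpha> * g x (T x) * \<alpha> ^ n" for n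
      using d_iter[OF x T[OF x], of n] by (simp add: \<sigma>_def funpow_swap1)
  qed (use \<alpha> \<sigma> in auto)
  then obtain u where lim: "limitin mtopology \<sigma> u sequentially"
    using assms(3) unfolding mcomplete_def by blast
  then have u: "u \<in> X" and d0: "(\<lambda>n. d (\<sigma> n) u) \<longlonglongrightarrow> 0"
    by (auto simp: limitin_metric_dist_null)
  \<comment> \<open>Continuity of \<open>T\<close> is not assumed; regularity supplies what replaces
    it at \<open>u\<close>, by making the bound in \<open>d_le\<close> vanish along
    \<sigma>.\<close>
  have "(\<lambda>n. d (\<sigma> n) u * \<delta> (\<sigma> n) u) \<longlonglongrightarrow> 0"
    using assms(7) u \<sigma> d0 unfolding regular_semimetric_def by blast
  then have "(\<lambda>n. 2 * \<alpha> * g (\<sigma> n) u) \<longlonglongrightarrow> 2 * \<alpha> * sqrt 0"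
    unfolding g_def by (intro tendsto_intros)
  then have null: "(\<lambda>n. 2 * \<alpha> * g (\<sigma> n) u) \<longlonglongrightarrow> 0"
    by simp
  have "norm (d (T (\<sigma> n)) (T u)) \<le> 2 * \<alpha> * g (\<sigma> n) u" for n
    using d_le[OF \<sigma> u] by simp
  then have "(\<lambda>n. d (T (\<sigma> n)) (T u)) \<longlonglongrightarrow> 0"
    by (intro Lim_null_comparison[OF always_eventually null] allI)
  moreover have "T (\<sigma> n) = \<sigma> (Suc n)" for n by (simp add: \<sigma>_def)
  ultimately have "(\<lambda>n. d (\<sigma> n) (T u)) \<longlonglongrightarrow> 0"
    by (simp add: LIMSEQ_imp_Suc)
  then have "limitin mtopology \<sigma> (T u) sequentially"
    using \<sigma> T u by (simp add: limitin_metric_dist_null)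
  then have fixed: "T u = u"
    using lim limitin_metric_unique trivial_limit_sequentially by blast
  \<comment> \<open>If \<open>v\<close> is fixed too, the orbit of \<open>u\<close> converges both
    to \<open>v\<close> and to \<open>u\<close>.\<close>
  have unique: "v = u" if "v \<in> X" "T v = v" for v
    using to_fixed[OF u that] to_fixed[OF u u fixed] limitin_metric_unique
      trivial_limit_sequentially by blast
  show ?thesis
    unfolding Picard_operator_def using u fixed unique to_fixed by blast
qed

end
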